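(* Let $t_0>0$, let $\lambda,\gamma>0$, let $g:\mathbb{R}^n\to\mathbb{R}$ be a Fréchet differentiable function (possibly nonconvex) whose gradient $\nabla g$ is Lipschitz continuous on $\mathbb{R}^n$, and assume that $g$ is bounded from below. For $u_0,v_0\in\mathbb{R}^n$, let $x:[t_0,+\infty)\to\mathbb{R}^n$ be the unique strong global solution of the dynamical system $$\frac{\lambda}{t^2}\ddot{x}(t)+\frac{\gamma}{t}\dot{x}(t)+\nabla g(x(t))=0,\qquad x(t_0)=u_0,\ \dot{x}(t_0)=v_0.$$ Consider the function $H:\mathbb{R}^n\times\mathbb{R}^n\to\mathbb{R}$, $H(x,y)=g(x)+\frac12\|x-y\|^2$. Suppose that $x$ is bounded and that $H$ is a KL function. Then: (a) $\dot{x}\in L^1([t_0,+\infty),\mathbb{R}^n)$; (b) the function $t\mapsto\frac{1}{t}\ddot{x}(t)$ belongs to $L^1([t_0,+\infty),\mathbb{R}^n)$; (c) there exists $\bar{x}\in\operatorname{crit}(g)$ such that $\lim_{t\to+\infty}x(t)=\bar{x}$.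
   Context: Finite-dimensional spaces carry the Euclidean norm. $\operatorname{crit}(g)=\{z\in\mathbb{R}^n:\nabla g(z)=0\}$. Strong global solution: a function $x:[t_0,+\infty)\to\mathbb{R}^n$ such that (i) $x,\dot x,\ddot x:[t_0,+\infty)\to\mathbb{R}^n$ are locally absolutely continuous, i.e. absolutely continuous on each interval $[t_0,b]$ with $t_0<b<+\infty$; (ii) $\frac{\lambda}{t^2}\ddot{x}(t)+\frac{\gamma}{t}\dot{x}(t)+\nabla g(x(t))=0$ for almost every $t\ge t_0$; (iii) $x(t_0)=u_0$ and $\dot x(t_0)=v_0$. Under the stated assumptions such a solution exists and is unique. KL function: for $\eta\in(0,+\infty]$ let $\Theta_\eta$ be the class of concave and continuous functions $\varphi:[0,\eta)\to[0,+\infty)$ such that $\varphi(0)=0$, $\varphi$ is continuously differentiable on $(0,\eta)$, and $\varphi'(s)>0$ for all $s\in(0,\eta)$. A differentiable function $f:\mathbb{R}^m\to\mathbb{R}$ satisfies the Kurdyka–Łojasiewicz (KL) property at $\bar z\in\mathbb{R}^m$ if there exist $\eta\in(0,+\infty]$, a neighborhood $U$ of $\bar z$ and $\varphi\in\Theta_\eta$ such that $\varphi'(f(z)-f(\bar z))\,\|\nabla f(z)\|\ge1$ for all $z\in U$ with $f(\bar z)<f(z)<f(\bar z)+\eta$. $f$ is a KL function if it satisfies the KL property at every point of $\mathbb{R}^m$. *)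

theory Defs
  imports "HOL-Analysis.Analysis"
begin

definition grad :: "('a::real_inner \<Rightarrow> real) \<Rightarrow> 'a \<Rightarrow> 'a" where
  "grad f z = (THE D. GDERIV f z :> D)"

lemma grad_eqI:
  assumes "GDERIV f z :> D"
  shows "grad f z = D"
  unfolding grad_def
proof (rule the_equality)
  fix E assume "GDERIV f z :> E"
  then have "(\<lambda>h. h \<bullet> E) = (\<lambda>h. h \<bullet> D)"
    using assms unfolding gderiv_def by (rule has_derivative_unique)
  then have "h \<bullet> (E - D) = 0" for h
    by (metis inner_diff_right right_minus_eq)
  from this[of "E - D"] show "E = D" by simp
qed (rule assms)

lemma gderiv_grad:
  fixes f :: "'a::euclidean_space \<Rightarrow> real"
  assumes "f differentiable (at z)"
  shows "GDERIV f z :> grad f z"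
proof -
  obtain f' where f': "(f has_derivative f') (at z)"
    using assms unfolding differentiable_def by blast
  then interpret linear f' by (rule has_derivative_linear)
  have "f' h = h \<bullet> adjoint f' 1" for h
    using adjoint_works[OF linear_axioms, of h 1] by simp
  then have "f' = (\<lambda>h. h \<bullet> adjoint f' 1)" by blast
  with f' have "GDERIV f z :> adjoint f' 1" unfolding gderiv_def by simp
  then show ?thesis using grad_eqI by metis
qed

definition crit :: "('a::real_inner \<Rightarrow> real) \<Rightarrow> 'a set" where
  "crit g = {z. grad g z = 0}"

text \<open>The members of \<open>D\<close> below are non-overlapping compact intervals \<open>{Inf K..Sup K}\<close>;
  degenerate ones contribute nothing to either sum.\<close>

definition abs_continuous_on :: "real \<Rightarrow> real \<Rightarrow> (real \<Rightarrow> 'a::real_normed_vector) \<Rightarrow> bool" where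
  "abs_continuous_on a b f \<longleftrightarrow>
     (\<forall>\<epsilon>>0. \<exists>\<delta>>0. \<forall>D. D division_of \<Union>D \<and> \<Union>D \<subseteq> {a..b} \<and> (\<Sum>K\<in>D. Sup K - Inf K) < \<delta> \<longrightarrow>
        (\<Sum>K\<in>D. norm (f (Sup K) - f (Inf K))) < \<epsilon>)"

definition loc_abs_continuous_from :: "real \<Rightarrow> (real \<Rightarrow> 'a::real_normed_vector) \<Rightarrow> bool" where
  "loc_abs_continuous_from t0 f \<longleftrightarrow> (\<forall>b>t0. abs_continuous_on t0 b f)"

text \<open>The derivative of a curve on \<open>{t0..}\<close>, one-sided at the left end point.\<close>

definition deriv_from :: "real \<Rightarrow> (real \<Rightarrow> 'a::real_normed_vector) \<Rightarrow> real \<Rightarrow> 'a" where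
  "deriv_from t0 x t = vector_derivative x (at t within {t0..})"

text \<open>The differentiability conditions make the first and second derivatives genuine
  functions on all of \<open>{t0..}\<close>; since they are required to be locally absolutely continuous
  (hence continuous), this is no more restrictive than almost everywhere differentiability
  of the locally absolutely continuous functions involved.\<close>

definition strong_global_solution ::
  "real \<Rightarrow> real \<Rightarrow> ('a::euclidean_space \<Rightarrow> real) \<Rightarrow> real \<Rightarrow> 'a \<Rightarrow> 'a \<Rightarrow> (real \<Rightarrow> 'a) \<Rightarrow> bool" where
  "strong_global_solution lam gam g t0 u0 v0 x \<longleftrightarrow>
     x differentiable_on {t0..} \<and>
     deriv_from t0 x differentiable_on {t0..} \<and>
     loc_abs_continuous_from t0 x \<and>
     loc_abs_continuous_from t0 (deriv_from t0 x) \<and>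
     loc_abs_continuous_from t0 (deriv_from t0 (deriv_from t0 x)) \<and>
     (AE t in lborel. t \<ge> t0 \<longrightarrow>
        (lam / t\<^sup>2) *\<^sub>R deriv_from t0 (deriv_from t0 x) t
          + (gam / t) *\<^sub>R deriv_from t0 x t + grad g (x t) = 0) \<and>
     x t0 = u0 \<and> deriv_from t0 x t0 = v0"

definition KL_desingularizing :: "ereal \<Rightarrow> (real \<Rightarrow> real) set" where
  "KL_desingularizing \<eta> = {\<phi>.
     concave_on {s. 0 \<le> s \<and> ereal s < \<eta>} \<phi> \<and>
     continuous_on {s. 0 \<le> s \<and> ereal s < \<eta>} \<phi> \<and>
     (\<forall>s. 0 \<le> s \<and> ereal s < \<eta> \<longrightarrow> \<phi> s \<ge> 0) \<and>
     \<phi> 0 = 0 \<and>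
     (\<forall>s. 0 < s \<and> ereal s < \<eta> \<longrightarrow> \<phi> differentiable (at s)) \<and>
     continuous_on {s. 0 < s \<and> ereal s < \<eta>} (deriv \<phi>) \<and>
     (\<forall>s. 0 < s \<and> ereal s < \<eta> \<longrightarrow> deriv \<phi> s > 0)}"

definition KL_property_at :: "('a::euclidean_space \<Rightarrow> real) \<Rightarrow> 'a \<Rightarrow> bool" where
  "KL_property_at f z0 \<longleftrightarrow>
     (\<exists>\<eta> U \<phi>. 0 < \<eta> \<and> open U \<and> z0 \<in> U \<and> \<phi> \<in> KL_desingularizing \<eta> \<and>
        (\<forall>z\<in>U. f z0 < f z \<and> ereal (f z) < ereal (f z0) + \<eta> \<longrightarrow>
           deriv \<phi> (f z - f z0) * norm (grad f z) \<ge> 1))"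

definition KL_function :: "('a::euclidean_space \<Rightarrow> real) \<Rightarrow> bool" where
  "KL_function f \<longleftrightarrow> f differentiable_on UNIV \<and> (\<forall>z. KL_property_at f z)"

end

theory Submission
  imports Defs
begin

text \<open>In the time \<open>\<tau> = t\<^sup>2 / 2\<close> the system becomes the heavy ball equation
  \<open>\<lambda> x'' + (\<gamma> + \<lambda> / (2 \<tau>)) x' + \<nabla>g(x) = 0\<close>, whose damping does not vanish. With \<open>p = x'\<close> and \<open>q = x''\<close>
  taken with respect to \<open>\<tau>\<close>, small \<open>a > 0\<close> and \<open>c\<^sup>2 = \<lambda> + a \<gamma>\<close>, the curve \<open>X = (x + a p, x + (a + c) p)\<close>
  satisfies \<open>d/d\<tau> H(X) \<le> - \<delta> w\<^sup>2\<close>, \<open>\<parallel>\<nabla>H(X)\<parallel> \<le> K w\<close> and \<open>\<parallel>dX/d\<tau>\<parallel> \<le> C w\<close> for \<open>w = \<parallel>p\<parallel> + \<parallel>q\<parallel>\<close>.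
  The first estimate makes \<open>w\<close> small along a sequence on which \<open>x\<close> converges, which gives a cluster point
  of \<open>X\<close> on the diagonal; the KL inequality there shows that \<open>\<phi>(H(X) - H(X\<^sub>\<infinity>))\<close> decreases at least at
  rate \<open>(\<delta> / K) w\<close>, so \<open>X\<close> is trapped near the cluster point and \<open>w\<close> is integrable in \<open>\<tau>\<close>.\<close>

section \<open>Integrability on half-lines\<close>

text \<open>The integrals over \<open>{a..t}\<close> increase with \<open>t\<close> and are bounded,
  so they converge to their supremum, which for nonnegative \<open>h\<close> is the integral over
  the half-line.\<close>

lemma integrable_on_atLeast_bounded:
  fixes h :: "real \<Rightarrow> real"
  assumes cont: "continuous_on {a..} h"
    and nonneg: "\<And>t. t \<ge> a \<Longrightarrow> h t \<ge> 0"
    and bound: "\<And>t. t \<ge> a \<Longrightarrow> integral {a..t} h \<le> B"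
  shows "h integrable_on {a..}"
proof -
  define F where "F = (\<lambda>t. integral {a..t} h)"
  have int: "h integrable_on {a..t}" for t
    by (rule integrable_continuous_interval) (rule continuous_on_subset[OF cont], auto)
  have mono: "F s \<le> F t" if "s \<le> t" for s t
    unfolding F_def using that by (intro integral_subset_le int) (auto intro: nonneg)
  have bdd: "bdd_above (F ` {a..})"
    using bound unfolding F_def by (intro bdd_aboveI[of _ B]) auto
  have le: "F t \<le> (SUP s\<in>{a..}. F s)" if "t \<ge> a" for t
    using that by (intro cSUP_upper bdd) auto
  have "(F \<longlongrightarrow> (SUP s\<in>{a..}. F s)) at_top"
  proof (rule increasing_tendsto)
    show "\<forall>\<^sub>F t in at_top. F t \<le> (SUP s\<in>{a..}. F s)"
      using eventually_ge_at_top[of a] by eventually_elim (rule le)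
    fix y assume "y < (SUP s\<in>{a..}. F s)"
    then obtain s where "y < F s"
      by (subst (asm) less_cSUP_iff) (use bdd in auto)
    show "\<forall>\<^sub>F t in at_top. y < F t"
      using eventually_ge_at_top[of s] by eventually_elim (use \<open>y < F s\<close> mono in force)
  qed
  then show ?thesis
    using has_integral_to_inf[OF int _ nonneg, of "SUP s\<in>{a..}. F s"] unfolding F_def by blast
qed

text \<open>The dynamical estimates start at a later time \<open>b\<close>, while integrability is
  claimed from \<open>a\<close>; continuity settles the compact piece \<open>{a..b}\<close>.\<close>

lemma absolutely_integrable_on_atLeast_tail_bounded:
  fixes f :: "real \<Rightarrow> 'b::euclidean_space"
  assumes cont: "continuous_on {a..} f" and "a \<le> b"
    and h: "h integrable_on {b..}"
    and bound: "\<And>t. t \<ge> b \<Longrightarrow> norm (f t) \<le> h t"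
  shows "f absolutely_integrable_on {a..}"
proof -
  have "f absolutely_integrable_on {a..b}"
    by (rule absolutely_integrable_continuous_real) (rule continuous_on_subset[OF cont], auto)
  moreover have "f absolutely_integrable_on {b..}"
    by (rule measurable_bounded_by_integrable_imp_absolutely_integrable[OF _ _ h])
      (use \<open>a \<le> b\<close> bound in \<open>auto intro!: continuous_imp_measurable_on_sets_lebesgue
        continuous_on_subset[OF cont]\<close>)
  ultimately have "f absolutely_integrable_on ({a..b} \<union> {b..})"
    by (rule set_integrable_Un) auto
  moreover have "{a..b} \<union> {b..} = {a..}" using \<open>a \<le> b\<close> by auto
  ultimately show ?thesis by simp
qed

section \<open>Descent curves of a KL function\<close>

lemma GDERIV_has_real_derivative_compose:
  assumes "GDERIV f (X t) :> D" "(X has_vector_derivative X') (at t)"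
  shows "((\<lambda>t. f (X t)) has_real_derivative D \<bullet> X') (at t)"
proof -
  have "((\<lambda>t. f (X t)) has_derivative (\<lambda>h. (h *\<^sub>R X') \<bullet> D)) (at t)"
    using has_derivative_compose[of X "\<lambda>h. h *\<^sub>R X'" t UNIV f "\<lambda>h. h \<bullet> D"] assms
    unfolding gderiv_def has_vector_derivative_def by simp
  moreover have "(\<lambda>h. (h *\<^sub>R X') \<bullet> D) = (*) (D \<bullet> X')"
    by (auto simp: inner_commute mult.commute)
  ultimately show ?thesis unfolding has_field_derivative_def by simp
qed

text \<open>The weight \<open>\<rho>\<close> stands for a change of time: in the time \<open>\<tau>\<close> with \<open>d\<tau> = \<rho> dt\<close> the curve
  moves with speed \<open>O(w)\<close> and \<open>H\<close> decreases along it at rate at least \<open>\<delta> w\<^sup>2\<close>.\<close>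

locale KL_descent_curve =
  fixes H :: "'a::euclidean_space \<Rightarrow> real" and X X' :: "real \<Rightarrow> 'a"
    and \<rho> w :: "real \<Rightarrow> real" and T C K \<delta> :: real and Xb :: 'a and s :: "nat \<Rightarrow> real"
  assumes pos: "C > 0" "K > 0" "\<delta> > 0"
    and KL: "KL_function H"
    and \<rho>_pos: "\<And>t. t \<ge> T \<Longrightarrow> \<rho> t > 0"
    and w_nonneg: "\<And>t. t \<ge> T \<Longrightarrow> w t \<ge> 0"
    and cont: "continuous_on {T..} (\<lambda>t. \<rho> t * w t)"
    and X: "\<And>t. t \<ge> T \<Longrightarrow> (X has_vector_derivative X' t) (at t)"
    and speed: "\<And>t. t \<ge> T \<Longrightarrow> norm (X' t) \<le> C * (\<rho> t * w t)"
    and descent: "\<And>t. t \<ge> T \<Longrightarrow> grad H (X t) \<bullet> X' t \<le> - \<delta> * \<rho> t * (w t)\<^sup>2"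
    and grad_bound: "\<And>t. t \<ge> T \<Longrightarrow> norm (grad H (X t)) \<le> K * w t"
    and s: "filterlim s at_top sequentially"
    and cluster: "(\<lambda>k. X (s k)) \<longlonglongrightarrow> Xb"
begin

lemma value_deriv: "t \<ge> T \<Longrightarrow> ((\<lambda>t. H (X t)) has_real_derivative grad H (X t) \<bullet> X' t) (at t)"
  using KL unfolding KL_function_def differentiable_on_def
  by (intro GDERIV_has_real_derivative_compose gderiv_grad X) auto

lemma value_antimono:
  assumes "T \<le> a" "a \<le> b"
  shows "H (X b) \<le> H (X a)"
proof (rule DERIV_nonpos_imp_nonincreasing[OF \<open>a \<le> b\<close>])
  fix t assume "a \<le> t" "t \<le> b"
  with assms have t: "t \<ge> T" by simp
  have "0 \<le> \<delta> * \<rho> t * (w t)\<^sup>2" using pos \<rho>_pos[OF t] by (simp add: less_imp_le)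
  with value_deriv[OF t] descent[OF t] show "\<exists>y. ((\<lambda>t. H (X t)) has_real_derivative y) (at t) \<and> y \<le> 0"
    by (intro exI conjI) auto
qed

lemma X_cont: "t \<ge> T \<Longrightarrow> isCont X t"
  by (rule has_vector_derivative_continuous[OF X])

lemma H_cont: "isCont H z"
  using KL unfolding KL_function_def differentiable_on_def
  by (auto intro: differentiable_imp_continuous_within)

lemma value_cluster: "(\<lambda>k. H (X (s k))) \<longlonglongrightarrow> H Xb"
  by (rule isCont_tendsto_compose[OF H_cont cluster])

lemma s_ge: "\<forall>\<^sub>F k in sequentially. s k \<ge> t"
  using s by (simp add: filterlim_at_top)

text \<open>The values decrease along the curve and tend to \<open>H Xb\<close> along
  \<open>s\<close>, so none of them can lie below this limit.\<close>

lemma value_ge: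
  assumes "t \<ge> T"
  shows "H Xb \<le> H (X t)"
proof (rule tendsto_upperbound[OF value_cluster])
  show "\<forall>\<^sub>F k in sequentially. H (X (s k)) \<le> H (X t)"
    using s_ge[of t] by eventually_elim (use assms in \<open>intro value_antimono\<close>)
qed simp

text \<open>After \<open>t'\<close> the value is squeezed between \<open>H Xb\<close> and itself.
  Descent then forces \<open>w = 0\<close>, the speed bound stops the curve, and the cluster point
  tells where it rests.\<close>

lemma constant_case:
  assumes t': "t' \<ge> T" "H (X t') = H Xb"
  shows "(\<lambda>t. \<rho> t * w t) integrable_on {T..} \<and> (X \<longlongrightarrow> Xb) at_top"
proof
  have Wc: "H (X t) = H Xb" if "t \<ge> t'" for t
    using value_antimono[of t' t] value_ge[of t] that t' by simp
  have w0: "w t = 0" if "t > t'" for t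
  proof -
    \<comment> \<open>The two-sided derivative sees a constant function only on an open set of
      times. Hence the strict \<open>t > t'\<close>, and below the tail that begins at
      \<open>t' + 1\<close>.\<close>
    have "((\<lambda>t. H (X t)) has_real_derivative 0) (at t)"
    proof (rule has_field_derivative_transform_within_open[OF DERIV_const])
      show "open {t'<..}" "t \<in> {t'<..}" using that by auto
      show "H Xb = H (X y)" if "y \<in> {t'<..}" for y using Wc[of y] that by simp
    qed
    then have "0 = grad H (X t) \<bullet> X' t"
      using value_deriv[of t] that t' by (intro DERIV_unique) auto
    then have "\<delta> * \<rho> t * (w t)\<^sup>2 \<le> 0" using descent[of t] that t' by simp
    then show ?thesis using pos \<rho>_pos[of t] that t' by (auto simp: mult_le_0_iff)
  qed
  have "(\<lambda>t. \<rho> t * w t) absolutely_integrable_on {T..}"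
  proof (rule absolutely_integrable_on_atLeast_tail_bounded[OF cont, where h = "\<lambda>_. 0" and b = "t' + 1"])
    show "norm (\<rho> t * w t) \<le> 0" if "t \<ge> t' + 1" for t using w0[of t] that by simp
  qed (use t' in \<open>auto intro: integrable_0\<close>)
  then show "(\<lambda>t. \<rho> t * w t) integrable_on {T..}" by (rule absolutely_integrable_on_def[THEN iffD1, THEN conjunct1])
  have "\<exists>c. \<forall>t\<in>{t'<..}. X t = c"
  proof (rule has_vector_derivative_zero_constant)
    fix t assume "t \<in> {t'<..}"
    then show "(X has_vector_derivative 0) (at t within {t'<..})"
      using X[of t] speed[of t] w0[of t] t' by (auto intro: has_vector_derivative_at_within)
  qed auto
  then obtain c where c: "\<And>t. t > t' \<Longrightarrow> X t = c" by auto
  have "(\<lambda>k. X (s k)) \<longlonglongrightarrow> c"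
  proof (rule tendsto_eventually)
    show "\<forall>\<^sub>F k in sequentially. X (s k) = c"
      using s_ge[of "t' + 1"] by eventually_elim (auto intro: c)
  qed
  with cluster have "c = Xb" by (intro LIMSEQ_unique)
  show "(X \<longlongrightarrow> Xb) at_top"
  proof (rule tendsto_eventually)
    show "\<forall>\<^sub>F t in at_top. X t = Xb"
      using eventually_gt_at_top[of t'] by eventually_elim (auto simp: c \<open>c = Xb\<close>)
  qed
qed

text \<open>A positive gap \<open>H (X t) - H Xb\<close> makes the KL inequality available while the
  curve is in \<open>U\<close> and the gap is small. There the decrease of \<open>\<psi>\<close>
  controls the integral of \<open>\<rho> * w\<close> and, up to the factor \<open>C\<close>, the
  displacement; starting late, where \<open>\<psi>\<close> is small, the curve cannot leave
  \<open>U\<close>.\<close>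

lemma strict_case:
  assumes gt: "\<And>t. t \<ge> T \<Longrightarrow> H (X t) > H Xb"
  shows "(\<lambda>t. \<rho> t * w t) integrable_on {T..} \<and> (X \<longlongrightarrow> Xb) at_top"
proof -
  obtain \<eta> U \<phi> where \<eta>: "0 < \<eta>" and U: "open U" "Xb \<in> U" and \<phi>: "\<phi> \<in> KL_desingularizing \<eta>"
    and ineq: "\<And>z. z \<in> U \<Longrightarrow> H Xb < H z \<Longrightarrow> ereal (H z) < ereal (H Xb) + \<eta> \<Longrightarrow>
           deriv \<phi> (H z - H Xb) * norm (grad H z) \<ge> 1"
    using KL unfolding KL_function_def KL_property_at_def by blast
  define v where "v = (\<lambda>t. H (X t) - H Xb)"
  \<comment> \<open>The factor \<open>K / \<delta>\<close> pays for the gradient bound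
    \<open>K\<close> and the descent rate \<open>\<delta>\<close>, so that the derivative of
    \<open>\<psi>\<close> is at most \<open>- \<rho> * w\<close>.\<close>
  define \<psi> where "\<psi> = (\<lambda>t. (K / \<delta>) * \<phi> (v t))"
  have v_anti: "v b \<le> v a" if "T \<le> a" "a \<le> b" for a b
    using value_antimono[OF that] by (simp add: v_def)
  have v_pos: "v t > 0" if "t \<ge> T" for t using gt[OF that] by (simp add: v_def)
  have v_lim: "(\<lambda>k. v (s k)) \<longlonglongrightarrow> 0"
    unfolding v_def using value_cluster by (simp add: LIM_zero)
  \<comment> \<open>Since \<open>\<eta>\<close> may be infinite, a finite \<open>e\<close> below it
    is fixed; it confines the late gaps to the compact interval \<open>{0..e}\<close> inside the
    domain of \<open>\<phi>\<close>.\<close>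
  obtain e where e: "e > 0" "ereal e < \<eta>"
    using ereal_dense2[OF \<eta>] by (auto simp: zero_ereal_def)
  have dom: "ereal y < \<eta>" if "y \<le> e" for y
    using that e(2) by (meson ereal_less_eq(3) le_less_trans)
  have \<phi>0: "\<phi> 0 = 0" and \<phi>_ge: "\<And>y. 0 \<le> y \<Longrightarrow> y \<le> e \<Longrightarrow> \<phi> y \<ge> 0"
    and \<phi>_diff: "\<And>y. 0 < y \<Longrightarrow> y \<le> e \<Longrightarrow> (\<phi> has_real_derivative deriv \<phi> y) (at y)"
    and \<phi>_cont: "continuous_on {0..e} \<phi>"
    using \<phi> dom unfolding KL_desingularizing_def
    by (auto simp: DERIV_deriv_iff_real_differentiable intro: continuous_on_subset)
  have small: "\<forall>\<^sub>F k in sequentially. v (s k) < e"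
    using v_lim e(1) by (rule order_tendstoD(2))
  have "(\<lambda>k. \<phi> (v (s k))) \<longlonglongrightarrow> \<phi> 0"
  proof (rule continuous_on_tendsto_compose[OF \<phi>_cont v_lim])
    show "\<forall>\<^sub>F k in sequentially. v (s k) \<in> {0..e}"
      using small s_ge[of T] by eventually_elim (use v_pos in \<open>auto intro: less_imp_le\<close>)
  qed (use e in auto)
  then have \<psi>_lim: "(\<lambda>k. \<psi> (s k)) \<longlonglongrightarrow> 0"
    unfolding \<psi>_def using tendsto_mult_left[of _ 0 sequentially "K / \<delta>"] \<phi>0 by simp
  define dv where "dv = (\<lambda>t. (K / \<delta>) * (deriv \<phi> (v t) * (grad H (X t) \<bullet> X' t)))"
  have \<psi>_deriv: "(\<psi> has_real_derivative dv t) (at t)" if "t \<ge> T" "v t < e" for t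
  proof -
    have "(v has_real_derivative grad H (X t) \<bullet> X' t) (at t)"
      unfolding v_def using value_deriv[OF that(1)] by (auto intro!: derivative_eq_intros)
    then have "((\<lambda>t. \<phi> (v t)) has_real_derivative deriv \<phi> (v t) * (grad H (X t) \<bullet> X' t)) (at t)"
      using that by (intro DERIV_chain2[OF \<phi>_diff] v_pos) auto
    then show ?thesis unfolding \<psi>_def dv_def by (rule DERIV_cmult)
  qed
  have \<psi>_ge: "\<psi> t \<ge> 0" if "t \<ge> T" "v t < e" for t
    unfolding \<psi>_def using that pos v_pos[of t] \<phi>_ge[of "v t"] by simp
  have key: "\<rho> t * w t \<le> - dv t" if t: "t \<ge> T" "v t < e" and "X t \<in> U" for t
  proof -
    have "ereal (H (X t)) = ereal (H Xb) + ereal (v t)" by (simp add: v_def)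
    also have "\<dots> < ereal (H Xb) + \<eta>"
      using dom[of "v t"] t by (intro ereal_less_add) auto
    finally have 1: "1 \<le> deriv \<phi> (v t) * norm (grad H (X t))"
      using ineq[OF \<open>X t \<in> U\<close> gt[OF t(1)]] by (simp add: v_def)
    have d: "deriv \<phi> (v t) > 0"
    proof (rule ccontr)
      assume "\<not> deriv \<phi> (v t) > 0"
      then have "deriv \<phi> (v t) * norm (grad H (X t)) \<le> 0" by (simp add: mult_nonpos_nonneg)
      with 1 show False by simp
    qed
    have "1 \<le> deriv \<phi> (v t) * (K * w t)"
      using 1 mult_left_mono[OF grad_bound[OF t(1)], of "deriv \<phi> (v t)"] d by linarith
    \<comment> \<open>Multiplying the KL inequality by \<open>\<rho> * w\<close> creates
      \<open>\<rho> * w\<^sup>2\<close>, which is exactly what the descent estimate bounds.\<close>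
    then have "\<rho> t * w t * 1 \<le> \<rho> t * w t * (deriv \<phi> (v t) * (K * w t))"
      using \<rho>_pos[OF t(1)] w_nonneg[OF t(1)] by (intro mult_left_mono) auto
    also have "\<dots> = (K / \<delta>) * (deriv \<phi> (v t) * (\<delta> * \<rho> t * (w t)\<^sup>2))"
      using pos by (simp add: field_simps power2_eq_square)
    also have "\<dots> \<le> (K / \<delta>) * (deriv \<phi> (v t) * - (grad H (X t) \<bullet> X' t))"
      using pos d descent[OF t(1)] by (intro mult_left_mono) auto
    finally show ?thesis unfolding dv_def by simp
  qed
  \<comment> \<open>Integrate the differential inequality and drop the final
    \<open>\<psi> b \<ge> 0\<close>. Membership in \<open>U\<close> is asked at interior times only,
    so that \<open>b\<close> may be a first exit time.\<close>
  have length: "norm (X b - X a) \<le> C * \<psi> a" "integral {a..b} (\<lambda>t. \<rho> t * w t) \<le> \<psi> a"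
    if "T \<le> a" "v a < e" "a \<le> b" and inU: "\<And>t. a < t \<Longrightarrow> t < b \<Longrightarrow> X t \<in> U" for a b
  proof -
    have *: "t \<ge> T \<and> v t < e" if "t \<ge> a" for t
      using v_anti[of a t] that \<open>T \<le> a\<close> \<open>v a < e\<close> by auto
    have cX: "continuous_on {a..b} X"
      using X_cont * by (intro continuous_at_imp_continuous_on) auto
    have c\<psi>: "continuous_on {a..b} \<psi>"
      using * by (intro continuous_at_imp_continuous_on ballI DERIV_isCont[OF \<psi>_deriv]) auto
    have chw: "continuous_on {a..b} (\<lambda>t. \<rho> t * w t)"
      by (rule continuous_on_subset[OF cont]) (use that in auto)
    define I where "I = (\<lambda>u. integral {a..u} (\<lambda>t. \<rho> t * w t))"
    have "norm (X b - X a) \<le> C * \<psi> a \<and> norm (I b - I a) \<le> \<psi> a"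
    proof (cases "a = b")
      case True
      then show ?thesis using \<psi>_ge[of a] that pos by (simp add: I_def)
    next
      case False
      then have "a < b" using that by simp
      have "norm (X b - X a) \<le> (\<lambda>t. - C * \<psi> t) b - (\<lambda>t. - C * \<psi> t) a"
      proof (rule differentiable_bound_general[OF \<open>a < b\<close> cX])
        show "(X has_vector_derivative X' t) (at t)"
          "((\<lambda>t. - C * \<psi> t) has_vector_derivative - C * dv t) (at t)"
          "norm (X' t) \<le> - C * dv t" if "a < t" "t < b" for t
          using * that X \<psi>_deriv[of t] speed[of t] mult_left_mono[OF key[of t], of C] inU[of t] pos
          by (auto simp: has_real_derivative_iff_has_vector_derivative[symmetric] intro!: derivative_eq_intros)
      qed (intro continuous_intros c\<psi>)
      moreover have "norm (I b - I a) \<le> (\<lambda>t. - \<psi> t) b - (\<lambda>t. - \<psi> t) a"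
      proof (rule differentiable_bound_general[OF \<open>a < b\<close>])
        show "continuous_on {a..b} I"
          unfolding I_def by (intro indefinite_integral_continuous_1 integrable_continuous_interval chw)
        show "(I has_vector_derivative \<rho> t * w t) (at t)"
          "((\<lambda>t. - \<psi> t) has_vector_derivative - dv t) (at t)"
          "norm (\<rho> t * w t) \<le> - dv t" if t: "a < t" "t < b" for t
        proof -
          have "(I has_vector_derivative \<rho> t * w t) (at t within {a..b})"
            unfolding I_def using t by (intro integral_has_vector_derivative chw) auto
          then show "(I has_vector_derivative \<rho> t * w t) (at t)"
            using t by (simp add: at_within_Icc_at)
          show "((\<lambda>t. - \<psi> t) has_vector_derivative - dv t) (at t)"
            using * t \<psi>_deriv[of t]
            by (auto simp: has_real_derivative_iff_has_vector_derivative[symmetric] intro!: derivative_eq_intros)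
          have "0 \<le> \<rho> t * w t" using * \<rho>_pos[of t] w_nonneg[of t] t by simp
          then show "norm (\<rho> t * w t) \<le> - dv t"
            using * t key[of t] inU[of t] by simp
        qed
      qed (intro continuous_intros c\<psi>)
      moreover have "\<psi> b \<ge> 0" using *[of b] \<psi>_ge[of b] that by simp
      moreover from this have "C * \<psi> b \<ge> 0" using pos by simp
      ultimately show ?thesis by simp
    qed
    then show "norm (X b - X a) \<le> C * \<psi> a" "integral {a..b} (\<lambda>t. \<rho> t * w t) \<le> \<psi> a"
      by (auto simp: I_def)
  qed
  have trap: "\<exists>a \<ge> T. v a < e \<and> (\<forall>t\<ge>a. X t \<in> ball Xb r)" if "r > 0" "ball Xb r \<subseteq> U" for r
  proof -
    have "\<forall>\<^sub>F k in sequentially. dist (X (s k)) Xb < r / 2"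
      using cluster that by (intro tendstoD) auto
    \<comment> \<open>The initial distance and the later displacement \<open>C * \<psi>\<close> each
      use less than \<open>r / 2\<close>, so together they stay below \<open>r\<close>.\<close>
    moreover have "\<forall>\<^sub>F k in sequentially. \<psi> (s k) < r / (2 * C)"
      using \<psi>_lim that pos by (intro order_tendstoD) auto
    ultimately have "\<forall>\<^sub>F k in sequentially. s k \<ge> T \<and> v (s k) < e \<and> dist (X (s k)) Xb < r / 2
        \<and> \<psi> (s k) < r / (2 * C)"
      using small s_ge[of T] by eventually_elim auto
    then obtain a where a: "a \<ge> T" "v a < e" "dist (X a) Xb < r / 2" "\<psi> a < r / (2 * C)"
      by (metis (mono_tags, lifting) eventually_happens trivial_limit_sequentially)
    have "X t \<in> ball Xb r" if "t \<ge> a" for t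
    proof (rule ccontr)
      assume out: "X t \<notin> ball Xb r"
      define S where "S = {u \<in> {a..t}. r \<le> dist (X u) Xb}"
      have "continuous_on {a..t} (\<lambda>u. dist (X u) Xb)"
        using X_cont a by (intro continuous_intros continuous_at_imp_continuous_on) auto
      then have "closed S"
        unfolding S_def by (intro continuous_on_closed_Collect_le continuous_on_const) auto
      have "t \<in> S" using out that by (simp add: S_def dist_commute)
      have bdd: "bdd_below S" by (auto simp: S_def intro: bdd_belowI[of _ a])
      \<comment> \<open>\<open>m\<close> is the first time at distance at least \<open>r\<close>:
        closedness puts it in \<open>S\<close>, while at all times between \<open>a\<close> and
        \<open>m\<close> the curve is still in the ball.\<close>
      define m where "m = Inf S"
      have m: "m \<in> S" unfolding m_def
        using \<open>closed S\<close> \<open>t \<in> S\<close> bdd by (intro closed_contains_Inf) auto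
      have "norm (X m - X a) \<le> C * \<psi> a"
      proof (rule length(1))
        fix u assume u: "a < u" "u < m"
        then have "u \<notin> S" using cInf_lower[OF _ bdd, of u] by (auto simp: m_def)
        then have "X u \<in> ball Xb r" using u m by (auto simp: S_def dist_commute)
        then show "X u \<in> U" using \<open>ball Xb r \<subseteq> U\<close> by blast
      qed (use a m in \<open>auto simp: S_def\<close>)
      also have "\<dots> < r / 2" using a(4) pos by (simp add: field_simps)
      finally have "dist (X m) Xb < r"
        using a(3) dist_triangle[of "X m" Xb "X a"] by (simp add: dist_norm)
      with m show False by (simp add: S_def)
    qed
    with a show ?thesis by blast
  qed
  obtain r where r: "r > 0" "ball Xb r \<subseteq> U" using U openE by blast
  obtain a where a: "a \<ge> T" "v a < e" "\<And>t. t \<ge> a \<Longrightarrow> X t \<in> U"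
    using trap[OF r] r by blast
  have "(\<lambda>t. \<rho> t * w t) integrable_on {a..}"
  proof (rule integrable_on_atLeast_bounded)
    show "continuous_on {a..} (\<lambda>t. \<rho> t * w t)"
      by (rule continuous_on_subset[OF cont]) (use a in auto)
    show "integral {a..t} (\<lambda>t. \<rho> t * w t) \<le> \<psi> a" if "t \<ge> a" for t
      using that a by (intro length) auto
    show "\<rho> t * w t \<ge> 0" if "t \<ge> a" for t using \<rho>_pos[of t] w_nonneg[of t] that a by simp
  qed
  then have "(\<lambda>t. \<rho> t * w t) absolutely_integrable_on {T..}"
    using \<rho>_pos w_nonneg a
    by (intro absolutely_integrable_on_atLeast_tail_bounded[OF cont a(1)])
      (auto simp: abs_mult less_imp_le)
  then have "(\<lambda>t. \<rho> t * w t) integrable_on {T..}" by (simp add: absolutely_integrable_on_def)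
  moreover have "(X \<longlongrightarrow> Xb) at_top"
  proof (rule tendstoI)
    fix d :: real assume "d > 0"
    \<comment> \<open>Capping the radius by \<open>r\<close> keeps the ball inside \<open>U\<close>,
      as \<open>trap\<close> demands.\<close>
    then obtain b where "\<And>t. t \<ge> b \<Longrightarrow> X t \<in> ball Xb (min r d)"
      using trap[of "min r d"] r by (auto simp: subset_iff)
    then show "\<forall>\<^sub>F t in at_top. dist (X t) Xb < d"
      by (auto simp: eventually_at_top_linorder dist_commute)
  qed
  ultimately show ?thesis by blast
qed

lemma finite_length: "(\<lambda>t. \<rho> t * w t) integrable_on {T..}"
  and convergence: "(X \<longlongrightarrow> Xb) at_top"
proof -
  have "(\<lambda>t. \<rho> t * w t) integrable_on {T..} \<and> (X \<longlongrightarrow> Xb) at_top"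
  proof (cases "\<exists>t'\<ge>T. H (X t') = H Xb")
    case True
    then show ?thesis using constant_case by blast
  next
    case False
    then show ?thesis using value_ge by (intro strict_case) (force simp: less_le)
  qed
  then show "(\<lambda>t. \<rho> t * w t) integrable_on {T..}" "(X \<longlongrightarrow> Xb) at_top" by auto
qed

end

section \<open>From absolute continuity and an almost everywhere equation to pointwise
  statements\<close>

lemma abs_continuous_on_imp_continuous_on:
  assumes "abs_continuous_on a b f"
  shows "continuous_on {a..b} f"
  unfolding continuous_on_iff
proof (intro ballI allI impI)
  fix u e :: real assume u: "u \<in> {a..b}" and "e > 0"
  obtain d where "d > 0" and d: "\<forall>D. D division_of \<Union>D \<and> \<Union>D \<subseteq> {a..b} \<and>
      (\<Sum>K\<in>D. Sup K - Inf K) < d \<longrightarrow> (\<Sum>K\<in>D. norm (f (Sup K) - f (Inf K))) < e"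
    using assms[unfolded abs_continuous_on_def, rule_format, OF \<open>e > 0\<close>] by blast
  \<comment> \<open>A division with the single member \<open>{r..s}\<close> reduces absolute
    continuity to uniform continuity.\<close>
  have *: "norm (f s - f r) < e" if "r \<in> {a..b}" "s \<in> {a..b}" "r \<le> s" "s - r < d" for r s
    using d[rule_format, of "{{r..s}}"] division_of_self[of r s] that by auto
  have "dist (f v) (f u) < e" if "v \<in> {a..b}" "dist v u < d" for v
    using *[of u v] *[of v u] u that by (cases "u \<le> v") (auto simp: dist_norm norm_minus_commute)
  with \<open>d > 0\<close> show "\<exists>d>0. \<forall>v\<in>{a..b}. dist v u < d \<longrightarrow> dist (f v) (f u) < e" by blast
qed

lemma loc_abs_continuous_from_imp_continuous_on:
  assumes "loc_abs_continuous_from a f"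
  shows "continuous_on {a..} f"
  unfolding continuous_on_eq_continuous_within
proof
  fix u assume u: "u \<in> {a..}"
  have "continuous_on {a..u + 1} f"
    using assms u unfolding loc_abs_continuous_from_def
    by (intro abs_continuous_on_imp_continuous_on) auto
  then have "continuous (at u within {a..u + 1}) f"
    using u by (simp add: continuous_on_eq_continuous_within)
  moreover have "at u within {a..u + 1} = at u within {a..}"
    by (rule at_within_nhd[of _ "{..<u + 1}"]) auto
  ultimately show "continuous (at u within {a..}) f" by simp
qed

text \<open>The times in \<open>{a<..}\<close> where \<open>F\<close> does not vanish form an open
  set by continuity and a negligible one by \<open>AE\<close>, hence an empty one.\<close>

lemma AE_eq_0_imp_eq_0:
  fixes F :: "real \<Rightarrow> 'b::real_normed_vector"
  assumes AE: "AE t in lborel. t \<ge> a \<longrightarrow> F t = 0" and cont: "continuous_on {a<..} F"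
    and "t > a"
  shows "F t = 0"
proof (rule ccontr)
  assume "F t \<noteq> 0"
  define S where "S = {a<..} \<inter> F -` (- {0})"
  have "open S" unfolding S_def
    by (rule continuous_open_preimage[OF cont]) auto
  moreover have "S \<noteq> {}" using \<open>F t \<noteq> 0\<close> \<open>t > a\<close> by (auto simp: S_def)
  moreover obtain N where N: "\<And>u. u \<in> space lborel - N \<Longrightarrow> u \<ge> a \<longrightarrow> F u = 0" "N \<in> null_sets lborel"
    by (rule AE_E3[OF AE]) blast
  have "negligible N"
    using N(2) by (simp add: negligible_iff_null_sets null_sets_completionI)
  then have "negligible S"
    by (rule negligible_subset) (use N(1) in \<open>auto simp: S_def\<close>)
  ultimately show False using open_not_negligible by blast
qed

section \<open>Gradient of \<open>H\<close> and a quadratic estimate\<close>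

lemma GDERIV_add_half_norm_diff_sq:
  fixes g :: "'a::euclidean_space \<Rightarrow> real"
  assumes "GDERIV g u :> G"
  shows "GDERIV (\<lambda>(x, y). g x + 1 / 2 * (norm (x - y))\<^sup>2) (u, v) :> (G + (u - v), v - u)"
proof -
  have "(g has_derivative (\<lambda>h. h \<bullet> G)) (at (fst (u, v)))"
    using assms by (simp add: gderiv_def)
  from has_derivative_compose[OF bounded_linear_imp_has_derivative[OF bounded_linear_fst] this]
  have g: "((\<lambda>z. g (fst z)) has_derivative (\<lambda>h. fst h \<bullet> G)) (at (u, v))" .
  have d: "((\<lambda>z. fst z - snd z) has_derivative (\<lambda>h. fst h - snd h)) (at (u, v))"
    by (intro bounded_linear_imp_has_derivative bounded_linear_sub bounded_linear_fst bounded_linear_snd)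
  have "((\<lambda>z. g (fst z) + 1 / 2 * ((fst z - snd z) \<bullet> (fst z - snd z))) has_derivative
      (\<lambda>h. h \<bullet> (G + (u - v), v - u))) (at (u, v))"
    by (rule has_derivative_eq_rhs[OF has_derivative_add[OF g has_derivative_mult_right[OF has_derivative_inner[OF d d]]]])
      (simp add: fun_eq_iff inner_prod_def inner_commute[of "u - v"] inner_add_right inner_diff_right
        inner_diff_left, simp add: inner_commute)
  then show ?thesis
    unfolding gderiv_def by (simp add: case_prod_unfold power2_norm_eq_inner)
qed

text \<open>\<open>P\<close> and \<open>Q\<close> will be the norms of \<open>p\<close> and
  \<open>q\<close>. By Young's inequality the two mixed terms cost a quarter of
  \<open>a * lam * Q\<^sup>2\<close> each, and \<open>small\<close> pays all terms in
  \<open>P\<^sup>2\<close> with half of \<open>gam * P\<^sup>2\<close>. The remaining halves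
  dominate the right-hand side because
  \<open>(P + Q)\<^sup>2 \<le> 2 * P\<^sup>2 + 2 * Q\<^sup>2\<close>.\<close>

lemma quadratic_absorption:
  fixes a L lam gam P Q :: real
  assumes "0 < a" "a \<le> 1" "lam > 0" "gam > 0" and small: "a * (L + lam + L\<^sup>2 / lam) \<le> gam / 2"
  shows "- gam * P\<^sup>2 - a * lam * Q\<^sup>2 + a * lam * (P * Q) + a * L * (P * (P + a * Q))
    \<le> - (min (a * lam) gam / 4) * (P + Q)\<^sup>2"
proof -
  have 1: "a * lam * (P * Q) \<le> a * lam * (Q\<^sup>2 / 4 + P\<^sup>2)"
  proof (rule mult_left_mono)
    have "0 \<le> (Q / 2 - P)\<^sup>2" by simp
    then show "P * Q \<le> Q\<^sup>2 / 4 + P\<^sup>2" by (simp add: power2_eq_square algebra_simps)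
  qed (use assms in simp)
  \<comment> \<open>This square is Young's inequality with the weight that leaves
    \<open>a * lam / 4\<close> at \<open>Q\<^sup>2\<close>; the resulting \<open>a^3\<close> is at
    most \<open>a\<close> since \<open>a \<le> 1\<close>.\<close>
  have "0 \<le> a * lam * (Q / 2 - a * L / lam * P)\<^sup>2" using assms by simp
  also have "\<dots> = a * lam * Q\<^sup>2 / 4 - a * L * (P * (a * Q)) + a^3 * (L\<^sup>2 / lam) * P\<^sup>2"
    using \<open>lam > 0\<close> by (simp add: power2_diff power_mult_distrib power_divide)
      (simp add: field_simps power2_eq_square power3_eq_cube)
  also have "a^3 * (L\<^sup>2 / lam) * P\<^sup>2 \<le> a * (L\<^sup>2 / lam) * P\<^sup>2"
    using assms power_decreasing[of 1 3 a] by (intro mult_right_mono) auto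
  finally have 2: "a * L * (P * (a * Q)) \<le> a * lam * Q\<^sup>2 / 4 + a * (L\<^sup>2 / lam) * P\<^sup>2" by simp
  have 3: "a * (L + lam + L\<^sup>2 / lam) * P\<^sup>2 \<le> gam / 2 * P\<^sup>2"
    by (rule mult_right_mono[OF small]) simp
  define d where "d = min (a * lam) gam / 4"
  have d: "0 \<le> d" "d \<le> gam / 4" "d \<le> a * lam / 4" using assms by (auto simp: d_def)
  have 4: "d * P\<^sup>2 \<le> gam / 4 * P\<^sup>2" "d * Q\<^sup>2 \<le> a * lam / 4 * Q\<^sup>2"
    by (intro mult_right_mono d zero_le_power2)+
  have "0 \<le> d * (P - Q)\<^sup>2" using d by simp
  then have 5: "d * (P + Q)\<^sup>2 \<le> 2 * (d * P\<^sup>2) + 2 * (d * Q\<^sup>2)"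
    by (simp add: power2_eq_square algebra_simps)
  have "a * L * (P * (P + a * Q)) = a * L * P\<^sup>2 + a * L * (P * (a * Q))"
    by (simp add: power2_eq_square algebra_simps)
  moreover have "a * (L + lam + L\<^sup>2 / lam) * P\<^sup>2 = a * L * P\<^sup>2 + a * lam * P\<^sup>2 + a * (L\<^sup>2 / lam) * P\<^sup>2"
    by (simp add: algebra_simps)
  moreover have "a * lam * (Q\<^sup>2 / 4 + P\<^sup>2) = a * lam * Q\<^sup>2 / 4 + a * lam * P\<^sup>2"
    by (simp add: algebra_simps)
  ultimately show ?thesis using 1 2 3 4 5 unfolding d_def[symmetric] by simp
qed

section \<open>The flow as a heavy ball system\<close>

locale vanishing_damping_flow =
  fixes g :: "'a::euclidean_space \<Rightarrow> real" and x y z :: "real \<Rightarrow> 'a"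
    and lam gam t0 L :: real
  assumes t0: "t0 > 0" and lam: "lam > 0" and gam: "gam > 0"
    and g_diff: "g differentiable_on UNIV" and lip: "L-lipschitz_on UNIV (grad g)"
    and g_bdd: "bdd_below (range g)"
    and y: "\<And>t. t > t0 \<Longrightarrow> (x has_vector_derivative y t) (at t)"
    and z: "\<And>t. t > t0 \<Longrightarrow> (y has_vector_derivative z t) (at t)"
    and y_cont: "continuous_on {t0..} y" and z_cont: "continuous_on {t0..} z"
    and eq: "\<And>t. t > t0 \<Longrightarrow> (lam / t\<^sup>2) *\<^sub>R z t + (gam / t) *\<^sub>R y t + grad g (x t) = 0"
    and x_bdd: "bounded (x ` {t0..})"
    and KL: "KL_function (\<lambda>(x, y). g x + 1 / 2 * (norm (x - y))\<^sup>2)"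
begin

text \<open>The choice \<open>c\<^sup>2 = lam + a * gam\<close> cancels the leading cross term \<open>p \<bullet> q\<close> in the derivative of
  \<open>H (X t)\<close>; the term \<open>a * lam\<close> in front of \<open>\<parallel>q\<parallel>\<^sup>2\<close> then appears because the first component of \<open>X\<close>
  is shifted by \<open>a *\<^sub>R p\<close>, and a small \<open>a\<close> absorbs the error made by evaluating \<open>grad g\<close> there.\<close>

definition H where "H = (\<lambda>(x, y). g x + 1 / 2 * (norm (x - y))\<^sup>2)"

definition p where "p t = (1 / t) *\<^sub>R y t"
text \<open>As \<open>d/d\<tau> = (1/t) d/dt\<close>, this is \<open>1 / t\<close> times the
  derivative of \<open>y t / t\<close> in \<open>t\<close>.\<close>

definition q where "q t = (1 / t\<^sup>2) *\<^sub>R z t - (1 / t ^ 3) *\<^sub>R y t"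
definition w where "w t = norm (p t) + norm (q t)"
definition a where "a = min 1 (gam / (2 * (L + lam + L\<^sup>2 / lam)))"
definition c where "c = sqrt (lam + a * gam)"
definition X where "X t = (x t + a *\<^sub>R p t, x t + (a + c) *\<^sub>R p t)"
text \<open>The derivative is taken in \<open>t\<close>; the factor \<open>t\<close> is
  \<open>d\<tau>/dt\<close>.\<close>

definition X' where "X' t = (t *\<^sub>R (p t + a *\<^sub>R q t), t *\<^sub>R (p t + (a + c) *\<^sub>R q t))"
text \<open>From here on \<open>t > t0\<close>, where derivatives are two-sided, and
  \<open>t \<ge> 1\<close>, so that \<open>lam / t\<^sup>2 \<le> lam\<close>.\<close>

definition T where "T = t0 + 1"
definition \<delta> where "\<delta> = min (a * lam) gam / 4"
definition K where "K = lam + gam + a * L + 2 * c"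

lemma T_bounds: "t \<ge> T \<Longrightarrow> t > t0 \<and> t \<ge> 1 \<and> t > 0" using t0 by (simp add: T_def)

lemma L_nonneg: "L \<ge> 0" by (rule lipschitz_on_nonneg[OF lip])

lemma a_bounds: "0 < a" "a \<le> 1" "a * (L + lam + L\<^sup>2 / lam) \<le> gam / 2"
proof -
  have pos: "L + lam + L\<^sup>2 / lam > 0" using L_nonneg lam by (simp add: add_nonneg_pos add_pos_nonneg)
  then show "0 < a" "a \<le> 1" using gam by (auto simp: a_def)
  have "a \<le> gam / (2 * (L + lam + L\<^sup>2 / lam))" by (simp add: a_def)
  with pos show "a * (L + lam + L\<^sup>2 / lam) \<le> gam / 2" by (simp add: field_simps)
qed

lemma c_props: "c > 0" "c\<^sup>2 = lam + a * gam"
  using a_bounds lam gam by (auto simp: c_def add_pos_pos less_imp_le)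

lemma \<delta>_pos: "\<delta> > 0" using a_bounds lam gam by (simp add: \<delta>_def)

lemma K_pos: "K > 0" unfolding K_def using a_bounds L_nonneg lam gam c_props by (simp add: add_pos_nonneg add_pos_pos)

lemma grad_H: "grad H (u, v) = (grad g u + (u - v), v - u)"
  unfolding H_def using g_diff
  by (intro grad_eqI GDERIV_add_half_norm_diff_sq gderiv_grad) (auto simp: differentiable_on_def)

lemma lip_le: "norm (grad g u - grad g v) \<le> L * norm (u - v)"
  using lipschitz_onD[OF lip, of u v] by (simp add: dist_norm)

lemma p_deriv:
  assumes "t > t0"
  shows "(p has_vector_derivative t *\<^sub>R q t) (at t)"
proof -
  have "t > 0" using assms t0 by simp
  have "((\<lambda>t. (1 / t) *\<^sub>R y t) has_vector_derivative
      (1 / t) *\<^sub>R z t + (- (1 / t\<^sup>2)) *\<^sub>R y t) (at t)"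
    by (rule has_vector_derivative_scaleR[OF _ z[OF assms]])
      (use \<open>t > 0\<close> in \<open>auto intro!: derivative_eq_intros simp: power2_eq_square field_simps\<close>)
  moreover have "t *\<^sub>R q t = (1 / t) *\<^sub>R z t + (- (1 / t\<^sup>2)) *\<^sub>R y t"
    using \<open>t > 0\<close> by (simp add: q_def scaleR_diff_right power2_eq_square power3_eq_cube)
  ultimately show ?thesis by (simp add: p_def[abs_def])
qed

lemma y_eq: "t > t0 \<Longrightarrow> y t = t *\<^sub>R p t"
  using t0 by (simp add: p_def)

lemma z_eq: "t > t0 \<Longrightarrow> (1 / t) *\<^sub>R z t = t *\<^sub>R q t + (1 / t) *\<^sub>R p t"
  using t0 by (simp add: p_def q_def scaleR_diff_right power2_eq_square power3_eq_cube)

lemma X_deriv: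
  assumes "t \<ge> T"
  shows "(X has_vector_derivative X' t) (at t)"
proof -
  have t: "t > t0" using T_bounds[OF assms] by simp
  have *: "((\<lambda>t. x t + b *\<^sub>R p t) has_vector_derivative t *\<^sub>R (p t + b *\<^sub>R q t)) (at t)" for b
    using y[OF t] p_deriv[OF t] y_eq[OF t] t t0
    by (auto intro!: derivative_eq_intros simp: scaleR_add_right)
  show ?thesis
    unfolding X_def[abs_def] X'_def by (intro has_vector_derivative_Pair *)
qed

text \<open>In the new time \<open>z t / t\<^sup>2\<close> is \<open>q + p / t\<^sup>2\<close>,
  which is the source of the extra damping \<open>lam / t\<^sup>2\<close>.\<close>

lemma gradient_eq:
  assumes "t > t0"
  shows "grad g (x t) = - ((gam + lam / t\<^sup>2) *\<^sub>R p t + lam *\<^sub>R q t)"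
proof -
  have "t > 0" using assms t0 by simp
  have "(gam + lam / t\<^sup>2) *\<^sub>R p t + lam *\<^sub>R q t = (lam / t\<^sup>2) *\<^sub>R z t + (gam / t) *\<^sub>R y t"
    using \<open>t > 0\<close> by (simp add: p_def q_def algebra_simps power2_eq_square power3_eq_cube)
  then show ?thesis using eq[OF assms] by (simp only: eq_neg_iff_add_eq_0 add.commute)
qed

section \<open>Speed, gradient and descent estimates\<close>

lemma damping_bounds:
  assumes "t \<ge> T"
  shows "0 \<le> lam / t\<^sup>2" "lam / t\<^sup>2 \<le> lam"
proof -
  have "1 \<le> t\<^sup>2" using T_bounds[OF assms] by simp
  then show "0 \<le> lam / t\<^sup>2" "lam / t\<^sup>2 \<le> lam" 
    using lam T_bounds[OF assms] mult_left_mono[of 1 "t\<^sup>2" lam] by (auto simp: divide_le_eq)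
qed

lemma gradient_bound:
  assumes "t \<ge> T"
  shows "norm (grad g (x t)) \<le> (lam + gam) * w t"
proof -
  have "norm (grad g (x t)) \<le> norm ((gam + lam / t\<^sup>2) *\<^sub>R p t) + norm (lam *\<^sub>R q t)"
    using gradient_eq[of t] T_bounds[OF assms] norm_triangle_ineq[of "(gam + lam / t\<^sup>2) *\<^sub>R p t" "lam *\<^sub>R q t"]
    by (simp only: norm_minus_cancel)
  also have "\<dots> = (gam + lam / t\<^sup>2) * norm (p t) + lam * norm (q t)"
    using lam gam damping_bounds[OF assms] by simp
  also have "\<dots> \<le> (lam + gam) * norm (p t) + (lam + gam) * norm (q t)"
    by (rule add_mono; rule mult_right_mono)
      (use lam gam damping_bounds[OF assms] in simp_all)
  finally show ?thesis by (simp add: w_def algebra_simps)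
qed

lemma w_nonneg: "w t \<ge> 0" by (simp add: w_def)

lemma speed:
  assumes "t \<ge> T"
  shows "norm (X' t) \<le> (2 + 2 * a + c) * (t * w t)"
proof -
  have t: "t > 0" using T_bounds[OF assms] by simp
  have "norm (X' t) \<le> norm (t *\<^sub>R (p t + a *\<^sub>R q t)) + norm (t *\<^sub>R (p t + (a + c) *\<^sub>R q t))"
    unfolding X'_def by (rule norm_Pair_le)
  also have "\<dots> = t * (norm (p t + a *\<^sub>R q t) + norm (p t + (a + c) *\<^sub>R q t))"
    using t by (simp add: distrib_left del: scaleR_add_right)
  also have "\<dots> \<le> t * ((norm (p t) + a * norm (q t)) + (norm (p t) + (a + c) * norm (q t)))"
    using t a_bounds(1) c_props(1) norm_triangle_ineq[of "p t" "a *\<^sub>R q t"] norm_triangle_ineq[of "p t" "(a + c) *\<^sub>R q t"]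
    by (intro mult_left_mono add_mono) auto
  also have "\<dots> \<le> t * ((2 + 2 * a + c) * w t)"
  proof (rule mult_left_mono)
    have "0 \<le> (2 * a + c) * norm (p t) + 2 * norm (q t)" using a_bounds(1) c_props(1) by simp
    then show "norm (p t) + a * norm (q t) + (norm (p t) + (a + c) * norm (q t)) \<le> (2 + 2 * a + c) * w t"
      by (simp add: w_def algebra_simps)
  qed (use t in simp)
  finally show ?thesis by (simp add: mult.left_commute)
qed

lemma grad_H_bound:
  assumes "t \<ge> T"
  shows "norm (grad H (X t)) \<le> K * w t"
proof -
  have "grad H (X t) = (grad g (x t + a *\<^sub>R p t) - c *\<^sub>R p t, c *\<^sub>R p t)"
    by (simp add: X_def grad_H algebra_simps)
  then have "norm (grad H (X t)) \<le> norm (grad g (x t + a *\<^sub>R p t) - c *\<^sub>R p t) + norm (c *\<^sub>R p t)"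
    using norm_Pair_le by metis
  also have "\<dots> \<le> norm (grad g (x t + a *\<^sub>R p t)) + 2 * c * norm (p t)"
  proof -
    have "norm (c *\<^sub>R p t) = c * norm (p t)" using c_props(1) by simp
    then show ?thesis using norm_triangle_ineq4[of "grad g (x t + a *\<^sub>R p t)" "c *\<^sub>R p t"] by linarith
  qed
  also have "norm (grad g (x t + a *\<^sub>R p t)) \<le> norm (grad g (x t)) + L * norm (a *\<^sub>R p t)"
    using lip_le[of "x t + a *\<^sub>R p t" "x t"]
      norm_triangle_ineq2[of "grad g (x t + a *\<^sub>R p t)" "grad g (x t)"] by simp
  also have "norm (grad g (x t)) \<le> (lam + gam) * w t" by (rule gradient_bound[OF assms])
  also have "L * norm (a *\<^sub>R p t) = a * L * norm (p t)" using a_bounds(1) by simp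
  finally have "norm (grad H (X t)) \<le> (lam + gam) * w t + (a * L + 2 * c) * norm (p t)"
    by (simp add: algebra_simps)
  also have "(a * L + 2 * c) * norm (p t) \<le> (a * L + 2 * c) * w t"
    using a_bounds(1) L_nonneg c_props(1) by (intro mult_left_mono) (auto simp: w_def)
  finally show ?thesis by (simp add: K_def algebra_simps)
qed

lemma descent:
  assumes "t \<ge> T"
  shows "grad H (X t) \<bullet> X' t \<le> - \<delta> * t * (w t)\<^sup>2"
proof -
  have t: "t > t0" "t > 0" using T_bounds[OF assms] by auto
  define P Q where "P = norm (p t)" and "Q = norm (q t)"
  define D where "D = grad g (x t + a *\<^sub>R p t) - grad g (x t)"
  \<comment> \<open>The components of \<open>X t\<close> differ by \<open>c *\<^sub>R p t\<close>;
    in the quadratic part of \<open>H\<close> the terms \<open>p \<bullet> p\<close> cancel and only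
    \<open>c\<^sup>2 * (p \<bullet> q)\<close> survives.\<close>
  have "grad H (X t) \<bullet> X' t = t * (grad g (x t + a *\<^sub>R p t) \<bullet> (p t + a *\<^sub>R q t) + c\<^sup>2 * (p t \<bullet> q t))"
    by (simp add: X_def X'_def grad_H inner_prod_def algebra_simps power2_eq_square)
  also have "grad g (x t + a *\<^sub>R p t) \<bullet> (p t + a *\<^sub>R q t) + c\<^sup>2 * (p t \<bullet> q t) \<le> - \<delta> * (w t)\<^sup>2"
  proof -
    have "grad g (x t + a *\<^sub>R p t) = D - ((gam + lam / t\<^sup>2) *\<^sub>R p t + lam *\<^sub>R q t)"
      using gradient_eq[OF t(1)] by (simp add: D_def)
    then have "grad g (x t + a *\<^sub>R p t) \<bullet> (p t + a *\<^sub>R q t) + c\<^sup>2 * (p t \<bullet> q t)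
        = D \<bullet> (p t + a *\<^sub>R q t) - ((gam + lam / t\<^sup>2) *\<^sub>R p t + lam *\<^sub>R q t) \<bullet> (p t + a *\<^sub>R q t)
          + c\<^sup>2 * (p t \<bullet> q t)"
      by (simp only: inner_diff_left)
    \<comment> \<open>Inserting \<open>c\<^sup>2 = lam + a * gam\<close> leaves as cross term only
      the contribution of the decaying damping \<open>lam / t\<^sup>2\<close>.\<close>
    also have "\<dots> = D \<bullet> (p t + a *\<^sub>R q t) - gam * P\<^sup>2 - lam / t\<^sup>2 * P\<^sup>2 - a * lam * Q\<^sup>2
          - a * (lam / t\<^sup>2) * (p t \<bullet> q t)"
      by (simp add: c_props P_def Q_def power2_norm_eq_inner algebra_simps inner_commute)
    also have "\<dots> \<le> a * L * (P * (P + a * Q)) - gam * P\<^sup>2 - a * lam * Q\<^sup>2 + a * lam * (P * Q)"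
    proof -
      have "D \<bullet> (p t + a *\<^sub>R q t) \<le> norm D * norm (p t + a *\<^sub>R q t)" by (rule norm_cauchy_schwarz)
      also have "\<dots> \<le> (a * L * P) * (P + a * Q)"
      proof (rule mult_mono)
        show "norm D \<le> a * L * P"
          using lip_le[of "x t + a *\<^sub>R p t" "x t"] a_bounds(1) by (simp add: D_def P_def mult_ac)
        show "norm (p t + a *\<^sub>R q t) \<le> P + a * Q"
          using norm_triangle_ineq[of "p t" "a *\<^sub>R q t"] a_bounds(1) by (simp add: P_def Q_def)
      qed (use a_bounds(1) L_nonneg in \<open>auto simp: P_def\<close>)
      finally have 1: "D \<bullet> (p t + a *\<^sub>R q t) \<le> a * L * (P * (P + a * Q))" by (simp add: mult.assoc)
      have "- (p t \<bullet> q t) \<le> P * Q"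
        using norm_cauchy_schwarz[of "- p t" "q t"] by (simp add: P_def Q_def)
      then have "a * (lam / t\<^sup>2) * - (p t \<bullet> q t) \<le> a * (lam / t\<^sup>2) * (P * Q)"
        using a_bounds(1) damping_bounds[OF assms] by (intro mult_left_mono mult_nonneg_nonneg) auto
      also have "\<dots> \<le> a * lam * (P * Q)"
        using a_bounds(1) damping_bounds[OF assms]
        by (intro mult_right_mono mult_left_mono) (auto simp: P_def Q_def)
      finally have "a * (lam / t\<^sup>2) * - (p t \<bullet> q t) \<le> a * lam * (P * Q)" .
      moreover have "0 \<le> lam / t\<^sup>2 * P\<^sup>2" using damping_bounds[OF assms] by simp
      ultimately show ?thesis using 1 by simp
    qed
    also have "\<dots> \<le> - \<delta> * (w t)\<^sup>2"
      using quadratic_absorption[OF a_bounds(1,2) lam gam a_bounds(3), of P Q] by (simp add: \<delta>_def w_def P_def Q_def)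
    finally show ?thesis .
  qed
  finally show ?thesis using t by (simp add: mult_left_mono mult.left_commute mult.commute)
qed

lemma KL_H: "KL_function H" using KL by (simp add: H_def)

lemma H_diff: "H differentiable (at u)"
  using KL_H unfolding KL_function_def differentiable_on_def by blast

lemma H_deriv:
  assumes "t \<ge> T"
  shows "((\<lambda>t. H (X t)) has_real_derivative grad H (X t) \<bullet> X' t) (at t)"
  by (intro GDERIV_has_real_derivative_compose gderiv_grad H_diff X_deriv assms)

section \<open>Cluster points and convergence\<close>

text \<open>If \<open>w\<close> stayed above \<open>e\<close>, then \<open>H (X t)\<close> would
  fall at least at the constant rate \<open>\<delta> * e\<^sup>2\<close>, contradicting the lower
  bound that \<open>H\<close> inherits from \<open>g\<close>.\<close>

lemma w_small:
  assumes "e > 0"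
  shows "\<exists>t\<ge>b. t \<ge> T \<and> w t < e"
proof (rule ccontr)
  assume "\<not> ?thesis"
  then have large: "w t \<ge> e" if "t \<ge> max b T" for t using that by force
  obtain m where m: "\<And>u. m \<le> g u" using g_bdd by (auto simp: bdd_below_def)
  have H_ge: "m \<le> H u" for u using m[of "fst u"] by (auto simp: H_def case_prod_unfold add_increasing2)
  define r where "r = \<delta> * e\<^sup>2"
  have r: "r > 0" using \<delta>_pos assms by (simp add: r_def)
  define b' where "b' = max b T"
  \<comment> \<open>The drop \<open>k\<close> is one more than the room above \<open>m\<close>, so
    at time \<open>t1\<close> the value would be at most \<open>m - 1\<close>.\<close>
  define k where "k = H (X b') - m + 1"
  define t1 where "t1 = b' + k / r"
  have "t1 \<ge> b'" using H_ge[of "X b'"] r by (simp add: t1_def k_def)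
  then have "H (X t1) + r * t1 \<le> H (X b') + r * b'"
  proof (rule DERIV_nonpos_imp_nonincreasing)
    fix t assume "b' \<le> t"
    then have t: "t \<ge> T" "w t \<ge> e" "t \<ge> 1" using large T_bounds[of t] by (auto simp: b'_def)
    have "r \<le> \<delta> * (w t)\<^sup>2" using \<delta>_pos t assms by (simp add: r_def power_mono)
    also have "\<dots> \<le> \<delta> * t * (w t)\<^sup>2" using \<delta>_pos t by (simp add: mult_right_mono)
    finally have "grad H (X t) \<bullet> X' t + r \<le> 0" using descent[OF t(1)] by simp
    moreover have "((\<lambda>t. H (X t) + r * t) has_real_derivative grad H (X t) \<bullet> X' t + r) (at t)"
      by (auto intro!: derivative_eq_intros H_deriv t)
    ultimately show "\<exists>y. ((\<lambda>t. H (X t) + r * t) has_real_derivative y) (at t) \<and> y \<le> 0" by blast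
  qed
  moreover have "r * t1 = r * b' + k" using r by (simp add: t1_def distrib_left)
  ultimately show False using H_ge[of "X t1"] by (simp add: k_def)
qed

text \<open>Times with \<open>w\<close> tending to 0 come from \<open>w_small\<close>; boundedness
  of \<open>x\<close> then selects a subsequence along which \<open>x\<close> converges.\<close>

lemma cluster_sequence:
  obtains s xb where "filterlim s at_top sequentially" "\<And>k. s k \<ge> T"
    "(\<lambda>k. w (s k)) \<longlonglongrightarrow> 0" "(\<lambda>k. x (s k)) \<longlonglongrightarrow> xb"
proof -
  have "\<forall>n::nat. \<exists>t. t \<ge> real n \<and> t \<ge> T \<and> w t < 1 / real (Suc n)"
    using w_small by (metis divide_pos_pos of_nat_0_less_iff zero_less_Suc zero_less_one)
  then obtain s :: "nat \<Rightarrow> real" where s: "\<And>n. s n \<ge> real n" "\<And>n. s n \<ge> T" "\<And>n. w (s n) < 1 / real (Suc n)"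
    by metis
  have "s n \<in> {t0..}" for n using T_bounds[OF s(2)[of n]] by simp
  then have "bounded (range (x \<circ> s))" by (intro bounded_subset[OF x_bdd]) auto
  then obtain xb r where r: "strict_mono (r :: nat \<Rightarrow> nat)" "((x \<circ> s) \<circ> r) \<longlonglongrightarrow> xb"
    using bounded_imp_convergent_subsequence by blast
  have s_top: "filterlim s at_top sequentially"
    by (rule filterlim_at_top_mono[OF filterlim_real_sequentially]) (simp add: s)
  have w0: "(\<lambda>n. w (s n)) \<longlonglongrightarrow> 0"
    by (rule tendsto_sandwich[OF _ _ tendsto_const LIMSEQ_Suc[OF lim_1_over_n]];
        intro always_eventually allI w_nonneg less_imp_le[OF s(3)])
  show ?thesis
  proof (rule that[of "s \<circ> r" xb])
    show "filterlim (s \<circ> r) at_top sequentially"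
      unfolding comp_def by (rule filterlim_compose[OF s_top filterlim_subseq[OF r(1)]])
    show "(\<lambda>k. w ((s \<circ> r) k)) \<longlonglongrightarrow> 0"
      using LIMSEQ_subseq_LIMSEQ[OF w0 r(1)] by (simp add: comp_def)
  qed (use s r in \<open>auto simp: comp_def\<close>)
qed

lemma w_cont: "continuous_on {t0..} w"
  unfolding w_def[abs_def] p_def q_def using t0
  by (intro continuous_intros y_cont z_cont) auto

theorem finite_length_and_limit:
  "y absolutely_integrable_on {t0..}"
  "(\<lambda>t. (1 / t) *\<^sub>R z t) absolutely_integrable_on {t0..}"
  "\<exists>xb \<in> crit g. (x \<longlongrightarrow> xb) at_top"
proof -
  obtain \<sigma> xb where \<sigma>: "filterlim \<sigma> at_top sequentially" "\<And>k. \<sigma> k \<ge> T"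
    and w0: "(\<lambda>k. w (\<sigma> k)) \<longlonglongrightarrow> 0" and xb: "(\<lambda>k. x (\<sigma> k)) \<longlonglongrightarrow> xb"
    using cluster_sequence by blast
  have p0: "(\<lambda>k. p (\<sigma> k)) \<longlonglongrightarrow> 0"
    by (rule Lim_null_comparison[OF _ w0]) (simp add: w_def)
  have "(\<lambda>k. x (\<sigma> k) + b *\<^sub>R p (\<sigma> k)) \<longlonglongrightarrow> xb" for b
    using tendsto_add[OF xb tendsto_scaleR[OF tendsto_const p0, of b]] by simp
  then have cluster: "(\<lambda>k. X (\<sigma> k)) \<longlonglongrightarrow> (xb, xb)"
    unfolding X_def by (intro tendsto_Pair)
  \<comment> \<open>The weight is \<open>t\<close> because \<open>d\<tau> = t dt\<close>; the limit
    is on the diagonal because \<open>p\<close> vanishes along \<open>\<sigma>\<close>.\<close>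
  interpret KL_descent_curve H X X' "\<lambda>t. t" w T "2 + 2 * a + c" K \<delta> "(xb, xb)" \<sigma>
  proof
    show "2 + 2 * a + c > 0" using a_bounds(1) c_props(1) by simp
    show "KL_function H" by (rule KL_H)
    show "continuous_on {T..} (\<lambda>t. t * w t)"
      by (intro continuous_intros continuous_on_subset[OF w_cont]) (auto simp: T_def)
    show "t > 0" if "t \<ge> T" for t using T_bounds[OF that] by simp
    show "w t \<ge> 0" for t by (rule w_nonneg)
  qed (fact K_pos \<delta>_pos \<sigma>(1) cluster X_deriv speed descent grad_H_bound)+
  have "t0 \<le> T" by (simp add: T_def)
  show "y absolutely_integrable_on {t0..}"
  proof (rule absolutely_integrable_on_atLeast_tail_bounded[OF y_cont \<open>t0 \<le> T\<close> finite_length])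
    show "norm (y t) \<le> t * w t" if "t \<ge> T" for t
      using y_eq[of t] T_bounds[OF that] by (simp add: w_def)
  qed
  show "(\<lambda>t. (1 / t) *\<^sub>R z t) absolutely_integrable_on {t0..}"
  proof (rule absolutely_integrable_on_atLeast_tail_bounded[OF _ \<open>t0 \<le> T\<close> finite_length])
    show "continuous_on {t0..} (\<lambda>t. (1 / t) *\<^sub>R z t)"
      using t0 by (intro continuous_intros z_cont) auto
    show "norm ((1 / t) *\<^sub>R z t) \<le> t * w t" if "t \<ge> T" for t
    proof -
      have t: "t > t0" "t \<ge> 1" using T_bounds[OF that] by auto
      have "norm ((1 / t) *\<^sub>R z t) \<le> norm (t *\<^sub>R q t) + norm ((1 / t) *\<^sub>R p t)"
        unfolding z_eq[OF t(1)] by (rule norm_triangle_ineq)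
      also have "norm ((1 / t) *\<^sub>R p t) \<le> t * norm (p t)"
      proof -
        have "1 / t \<le> t" using t mult_mono[of 1 t 1 t] by (simp add: divide_simps)
        then show ?thesis using t mult_right_mono[of "1 / t" t "norm (p t)"] by simp
      qed
      finally show ?thesis using t by (simp add: w_def algebra_simps)
    qed
  qed
  \<comment> \<open>\<open>x\<close> is a linear image of \<open>X\<close>: the difference of the
    components is \<open>c *\<^sub>R p t\<close>, so this combination removes
    \<open>a *\<^sub>R p t\<close> from the first one.\<close>
  have "((\<lambda>t. fst (X t) - (a / c) *\<^sub>R (snd (X t) - fst (X t))) \<longlongrightarrow>
      fst (xb, xb) - (a / c) *\<^sub>R (snd (xb, xb) - fst (xb, xb))) at_top"
    by (intro tendsto_intros convergence)
  moreover have "fst (X t) - (a / c) *\<^sub>R (snd (X t) - fst (X t)) = x t" for t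
    using c_props(1) by (simp add: X_def algebra_simps)
  ultimately have "(x \<longlongrightarrow> xb) at_top" by simp
  \<comment> \<open>Along \<open>\<sigma>\<close> the gradient is bounded by a multiple of
    \<open>w\<close>, which tends to 0 there, and \<open>grad g\<close> is continuous.\<close>
  moreover have "grad g xb = 0"
  proof (rule LIMSEQ_unique)
    show "(\<lambda>k. grad g (x (\<sigma> k))) \<longlonglongrightarrow> grad g xb"
      by (rule continuous_on_tendsto_compose[OF lipschitz_on_continuous_on[OF lip] xb]) auto
    show "(\<lambda>k. grad g (x (\<sigma> k))) \<longlonglongrightarrow> 0"
    proof (rule Lim_null_comparison)
      show "\<forall>\<^sub>F k in sequentially. norm (grad g (x (\<sigma> k))) \<le> (lam + gam) * w (\<sigma> k)"
        using gradient_bound \<sigma>(2) by simp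
      show "(\<lambda>k. (lam + gam) * w (\<sigma> k)) \<longlonglongrightarrow> 0"
        using tendsto_mult_left[OF w0, of "lam + gam"] by simp
    qed
  qed
  ultimately show "\<exists>xb \<in> crit g. (x \<longlongrightarrow> xb) at_top" by (auto simp: crit_def)
qed

end

section \<open>Strong global solutions\<close>

lemma has_vector_derivative_deriv_from:
  assumes "f differentiable_on {t0..}" "t > t0"
  shows "(f has_vector_derivative deriv_from t0 f t) (at t)"
proof -
  have "at t within {t0..} = at t"
    using assms(2) by (intro at_within_interior) simp
  moreover have "f differentiable (at t within {t0..})"
    using assms by (auto simp: differentiable_on_def)
  ultimately show ?thesis
    by (simp add: deriv_from_def vector_derivative_works)
qed

theorem theorem4p4:
  fixes g :: "real ^ 'n \<Rightarrow> real"
    and H :: "(real ^ 'n) \<times> (real ^ 'n) \<Rightarrow> real"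
    and x :: "real \<Rightarrow> real ^ 'n"
    and u0 v0 :: "real ^ 'n"
    and t0 lam gam :: real
  assumes "t0 > 0" and "lam > 0" and "gam > 0"
    and "g differentiable_on UNIV"
    and "\<exists>L. L-lipschitz_on UNIV (grad g)"
    and "bdd_below (range g)"
    and "strong_global_solution lam gam g t0 u0 v0 x"
    and "H = (\<lambda>(x, y). g x + 1 / 2 * (norm (x - y))\<^sup>2)"
    and "bounded (x ` {t0..})"
    and "KL_function H"
  shows "deriv_from t0 x absolutely_integrable_on {t0..}
    \<and> (\<lambda>t. (1 / t) *\<^sub>R deriv_from t0 (deriv_from t0 x) t) absolutely_integrable_on {t0..}
    \<and> (\<exists>xbar \<in> crit g. (x \<longlongrightarrow> xbar) at_top)"
proof -
  obtain L where L: "L-lipschitz_on UNIV (grad g)" using assms(5) by blast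
  let ?y = "deriv_from t0 x" and ?z = "deriv_from t0 (deriv_from t0 x)"
  note sol = assms(7)[unfolded strong_global_solution_def]
  have cont: "continuous_on {t0..} x" "continuous_on {t0..} ?y" "continuous_on {t0..} ?z"
    using sol by (auto intro: loc_abs_continuous_from_imp_continuous_on)
  have cont': "continuous_on {t0<..} x" "continuous_on {t0<..} ?y" "continuous_on {t0<..} ?z"
    using cont by (auto elim!: continuous_on_subset)
  \<comment> \<open>The left-hand side is continuous in \<open>t\<close>, so the almost everywhere
    equation holds at every \<open>t > t0\<close>.\<close>
  have eq: "(lam / t\<^sup>2) *\<^sub>R ?z t + (gam / t) *\<^sub>R ?y t + grad g (x t) = 0" if "t > t0" for t
  proof (rule AE_eq_0_imp_eq_0[OF _ _ that])
    show "continuous_on {t0<..} (\<lambda>t. (lam / t\<^sup>2) *\<^sub>R ?z t + (gam / t) *\<^sub>R ?y t + grad g (x t))"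
      using \<open>t0 > 0\<close> by (intro continuous_intros cont'
        continuous_on_compose2[OF lipschitz_on_continuous_on[OF L]]) auto
  qed (use sol in auto)
  interpret vanishing_damping_flow g x ?y ?z lam gam t0 L
  proof
    show "KL_function (\<lambda>(x, y). g x + 1 / 2 * (norm (x - y))\<^sup>2)"
      using assms(8,10) by simp
  qed (fact assms L cont eq | rule has_vector_derivative_deriv_from, use sol in blast, assumption)+
  show ?thesis using finite_length_and_limit by blast
qed

end
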